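(* Let $\mathbf A=(A;\cdot,\rightarrow,1)$ and $\mathbf B=(B;\cdot,\rightarrow,1)$ be hoops and let $f\colon B\to A$ be a product morphism. Then the $f$-product $\mathbf A\ltimes_f\mathbf B$ is a hoop.
   Context: A hoop is an algebra $\mathbf A=(A;\cdot,\rightarrow,1)$ of type $\langle 2,2,0\rangle$ such that $(A;\cdot,1)$ is a commutative monoid and the identities $x\rightarrow x=1$, $(x\cdot y)\rightarrow z=x\rightarrow(y\rightarrow z)$ and $x\cdot(x\rightarrow y)=y\cdot(y\rightarrow x)$ hold. The order is $x\leq y$ iff $x\rightarrow y=1$; infima exist and $x\wedge y=x\cdot(x\rightarrow y)$. A map $f\colon B\to A$ between hoops is a product morphism if $f(1)=1$ and $f(x)\cdot f(y)=f(x\cdot y)=f(x)\wedge f(y)=f(x\wedge y)$ for all $x,y\in B$. For such $f$, the $f$-product $\mathbf A\ltimes_f\mathbf B$ is the algebra whose universe is $\{(a,x)\in A\times B\mid a\leq f(x)\}$, with constant $(1,1)$ and operations $(a,x)\cdot(b,y)=(a\cdot b,\,x\cdot y)$ and $(a,x)\rightarrow(b,y)=(f(x\rightarrow y)\wedge(a\rightarrow b),\,x\rightarrow y)$. *)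

theory Defs
  imports "HOL-Algebra.Group"
begin

record 'a hoop_algebra = "'a monoid" +
  imp :: "'a \<Rightarrow> 'a \<Rightarrow> 'a" (infixr \<open>\<leadsto>\<index>\<close> 65)

locale hoop = comm_monoid A for A (structure) +
  assumes imp_closed [intro, simp]:
      "x \<in> carrier A \<Longrightarrow> y \<in> carrier A \<Longrightarrow> x \<leadsto> y \<in> carrier A"
    and imp_self: "x \<in> carrier A \<Longrightarrow> x \<leadsto> x = \<one>"
    and imp_curry:
      "x \<in> carrier A \<Longrightarrow> y \<in> carrier A \<Longrightarrow> z \<in> carrier A \<Longrightarrow>
        (x \<otimes> y) \<leadsto> z = x \<leadsto> (y \<leadsto> z)"
    and divisibility:
      "x \<in> carrier A \<Longrightarrow> y \<in> carrier A \<Longrightarrow> x \<otimes> (x \<leadsto> y) = y \<otimes> (y \<leadsto> x)"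

definition hoop_order :: "('a, 'm) hoop_algebra_scheme \<Rightarrow> 'a gorder" where
  "hoop_order A = \<lparr>carrier = carrier A, eq = (=), le = (\<lambda>x y. x \<leadsto>\<^bsub>A\<^esub> y = \<one>\<^bsub>A\<^esub>)\<rparr>"

abbreviation hoop_le :: "('a, 'm) hoop_algebra_scheme \<Rightarrow> 'a \<Rightarrow> 'a \<Rightarrow> bool" where
  "hoop_le A x y \<equiv> x \<sqsubseteq>\<^bsub>hoop_order A\<^esub> y"

text \<open>The infimum taken in the order of the hoop; lemmas \<open>greatest_meet\<close> and \<open>meet_eq\<close>
  below show that it exists and equals \<open>x \<otimes> (x \<leadsto> y)\<close>.\<close>

abbreviation hoop_meet :: "('a, 'm) hoop_algebra_scheme \<Rightarrow> 'a \<Rightarrow> 'a \<Rightarrow> 'a" where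
  "hoop_meet A x y \<equiv> x \<sqinter>\<^bsub>hoop_order A\<^esub> y"

definition product_morphism ::
  "('b, 'n) hoop_algebra_scheme \<Rightarrow> ('a, 'm) hoop_algebra_scheme \<Rightarrow> ('b \<Rightarrow> 'a) \<Rightarrow> bool" where
  "product_morphism B A f \<longleftrightarrow>
     f \<in> carrier B \<rightarrow> carrier A \<and>
     f \<one>\<^bsub>B\<^esub> = \<one>\<^bsub>A\<^esub> \<and>
     (\<forall>x \<in> carrier B. \<forall>y \<in> carrier B.
        f x \<otimes>\<^bsub>A\<^esub> f y = f (x \<otimes>\<^bsub>B\<^esub> y) \<and>
        f (x \<otimes>\<^bsub>B\<^esub> y) = hoop_meet A (f x) (f y) \<and>
        hoop_meet A (f x) (f y) = f (hoop_meet B x y))"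

definition f_product ::
  "('a, 'm) hoop_algebra_scheme \<Rightarrow> ('b \<Rightarrow> 'a) \<Rightarrow> ('b, 'n) hoop_algebra_scheme \<Rightarrow>
    ('a \<times> 'b) hoop_algebra" where
  "f_product A f B =
    \<lparr>carrier = {(a, x). a \<in> carrier A \<and> x \<in> carrier B \<and> hoop_le A a (f x)},
     mult = (\<lambda>(a, x) (b, y). (a \<otimes>\<^bsub>A\<^esub> b, x \<otimes>\<^bsub>B\<^esub> y)),
     one = (\<one>\<^bsub>A\<^esub>, \<one>\<^bsub>B\<^esub>),
     imp = (\<lambda>(a, x) (b, y).
       (hoop_meet A (f (x \<leadsto>\<^bsub>B\<^esub> y)) (a \<leadsto>\<^bsub>A\<^esub> b), x \<leadsto>\<^bsub>B\<^esub> y))\<rparr>"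

context hoop
begin

lemma hoop_order_simps [simp]:
  "carrier (hoop_order A) = carrier A"
  "eq (hoop_order A) = (=)"
  "hoop_le A x y \<longleftrightarrow> x \<leadsto> y = \<one>"
  by (simp_all add: hoop_order_def)

lemma one_imp_and_imp_one:
  assumes x: "x \<in> carrier A"
  shows "\<one> \<leadsto> x = x" "x \<leadsto> \<one> = \<one>"
proof -
  let ?u = "x \<leadsto> \<one>" and ?v = "\<one> \<leadsto> x"
  have v: "?v = x \<otimes> ?u" using divisibility[of \<one> x] x by simp
  have "x \<leadsto> ?v = \<one>" using imp_curry[of x \<one> x] x imp_self by simp
  then have x_eq: "x = ?v \<otimes> (?v \<leadsto> x)" using divisibility[of x ?v] x by simp
  have "?v \<leadsto> x = ?u \<leadsto> \<one>"
    using imp_curry[of ?u x x] v x imp_self m_comm[of x ?u] by simp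
  then have "x = x \<otimes> (?u \<otimes> (?u \<leadsto> \<one>))" using x_eq v x m_assoc by simp
  also have "?u \<otimes> (?u \<leadsto> \<one>) = ?u"
    using divisibility[of ?u \<one>] imp_curry[of \<one> x \<one>] x by simp
  finally have xu: "x = x \<otimes> ?u" .
  with v show "?v = x" by simp
  have "?u = (?u \<otimes> x) \<leadsto> \<one>" using xu x m_comm[of x ?u] by simp
  also have "\<dots> = \<one>" using imp_curry[of ?u x \<one>] x imp_self by simp
  finally show "?u = \<one>" .
qed

lemma imp_trans:
  assumes "x \<in> carrier A" "y \<in> carrier A" "z \<in> carrier A" "x \<leadsto> y = \<one>" "y \<leadsto> z = \<one>"
  shows "x \<leadsto> z = \<one>"
proof -
  have "x = (y \<leadsto> x) \<otimes> y" using assms divisibility[of x y] m_comm by simp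
  then have "x \<leadsto> z = (y \<leadsto> x) \<leadsto> (y \<leadsto> z)" using assms imp_curry[of "y \<leadsto> x" y z] by simp
  then show ?thesis using assms one_imp_and_imp_one by simp
qed

lemma imp_antisym:
  assumes "x \<in> carrier A" "y \<in> carrier A" "x \<leadsto> y = \<one>" "y \<leadsto> x = \<one>"
  shows "x = y"
  using divisibility[of x y] assms by simp

lemma partial_order_hoop_order: "partial_order (hoop_order A)"
  by unfold_locales (auto simp: imp_self intro: imp_trans imp_antisym)

lemma greatest_meet:
  assumes x: "x \<in> carrier A" and y: "y \<in> carrier A"
  shows "greatest (hoop_order A) (x \<otimes> (x \<leadsto> y)) (Lower (hoop_order A) {x, y})"
proof (rule greatest_LowerI)
  have below: "(x \<otimes> (x \<leadsto> y)) \<leadsto> y = \<one>" if "x \<in> carrier A" "y \<in> carrier A" for x y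
    using imp_curry[of "x \<leadsto> y" x y] m_comm[of x "x \<leadsto> y"] that imp_self by simp
  show "hoop_le A (x \<otimes> (x \<leadsto> y)) w" if "w \<in> {x, y}" for w
    using that below[OF x y] below[OF y x] divisibility[OF x y] by auto
  fix z assume "z \<in> Lower (hoop_order A) {x, y}"
  then have z: "z \<in> carrier A" "z \<leadsto> x = \<one>" "z \<leadsto> y = \<one>"
    using x y by (auto simp: Lower_def)
  let ?p = "x \<leadsto> z" and ?q = "x \<leadsto> y"
  have zeq: "z = ?p \<otimes> x" using divisibility[of x z] z x m_comm by simp
  have pq: "?p \<leadsto> ?q = \<one>" using imp_curry[of ?p x y] z x y zeq by simp
  have q: "?q \<leadsto> (x \<leadsto> (x \<otimes> ?q)) = \<one>"
    using imp_curry[of ?q x "x \<otimes> ?q"] m_comm[of x ?q] x y imp_self by simp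
  have "?p \<leadsto> (x \<leadsto> (x \<otimes> ?q)) = \<one>" by (rule imp_trans[OF _ _ _ pq q]) (use x y z in auto)
  then show "hoop_le A z (x \<otimes> ?q)"
    using imp_curry[of ?p x "x \<otimes> ?q"] x y z zeq by simp
qed (use x y in auto)

lemma meet_eq:
  assumes "x \<in> carrier A" "y \<in> carrier A"
  shows "hoop_meet A x y = x \<otimes> (x \<leadsto> y)"
  unfolding meet_def inf_def
  using greatest_meet[OF assms] partial_order.greatest_unique[OF partial_order_hoop_order]
  by (intro some_equality) auto

end

end

(* Values of f are idempotent, and multiplying by an idempotent e is the same as taking the
   meet with e, so the implication of the f-product is (f(x -> y) * (a -> b), x -> y).
   Currying then needs a * f(x -> (y -> z)) <= f(y -> z), which follows from a <= f(x) because f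
   is monotone and multiplicative; divisibility holds because a = f(x) * a lets f(x) absorb
   f(x -> y) into the symmetric factor f(x * (x -> y)). *)
theory Submission
  imports Defs
begin

context hoop
begin

lemma mult_imp_left:
  assumes "x \<in> carrier A" "y \<in> carrier A"
  shows "(x \<otimes> y) \<leadsto> x = \<one>"
  using imp_curry[of y x x] m_comm[of x y] assms imp_self one_imp_and_imp_one by simp

text \<open>Unit of the adjunction between multiplication by \<open>y\<close> and implication from
  \<open>y\<close>; monotonicity of the product is drawn from it by currying.\<close>

lemma imp_mult:
  assumes "x \<in> carrier A" "y \<in> carrier A"
  shows "x \<leadsto> (y \<leadsto> (x \<otimes> y)) = \<one>"
  using imp_curry[of x y "x \<otimes> y"] assms imp_self by simp

lemma mult_mono_left:
  assumes "x \<in> carrier A" "y \<in> carrier A" "z \<in> carrier A" "x \<leadsto> y = \<one>"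
  shows "(x \<otimes> z) \<leadsto> (y \<otimes> z) = \<one>"
  using imp_curry[of x z "y \<otimes> z"] imp_trans[OF _ _ _ assms(4) imp_mult] assms by simp

lemma mult_mono:
  assumes "x \<in> carrier A" "y \<in> carrier A" "z \<in> carrier A" "w \<in> carrier A"
    and "x \<leadsto> y = \<one>" "z \<leadsto> w = \<one>"
  shows "(x \<otimes> z) \<leadsto> (y \<otimes> w) = \<one>"
proof (rule imp_trans)
  show "(x \<otimes> z) \<leadsto> (y \<otimes> z) = \<one>" using assms by (intro mult_mono_left)
  show "(y \<otimes> z) \<leadsto> (y \<otimes> w) = \<one>"
    using mult_mono_left[of z w y] assms m_comm by simp
qed (use assms in auto)

text \<open>Counit of the same adjunction: by divisibility the left side is also a multiple of
  \<open>y\<close>.\<close>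

lemma meet_below_right:
  assumes "x \<in> carrier A" "y \<in> carrier A"
  shows "(x \<otimes> (x \<leadsto> y)) \<leadsto> y = \<one>"
  using mult_imp_left[of y "y \<leadsto> x"] divisibility[of x y] assms by simp

lemma imp_mono_right:
  assumes "x \<in> carrier A" "y \<in> carrier A" "z \<in> carrier A" "y \<leadsto> z = \<one>"
  shows "(x \<leadsto> y) \<leadsto> (x \<leadsto> z) = \<one>"
proof -
  have "((x \<leadsto> y) \<otimes> x) \<leadsto> y = \<one>"
    using meet_below_right[of x y] m_comm assms by simp
  then have "((x \<leadsto> y) \<otimes> x) \<leadsto> z = \<one>" by (rule imp_trans[rotated 3]) (use assms in auto)
  then show ?thesis using imp_curry assms by simp
qed

text \<open>Divisibility writes an element below \<open>e\<close> as a multiple of \<open>e\<close>,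
  and the leading \<open>e\<close> swallows a further factor \<open>e\<close>.\<close>

lemma idem_mult_absorb:
  assumes "e \<in> carrier A" "x \<in> carrier A" "e \<otimes> e = e" "x \<leadsto> e = \<one>"
  shows "e \<otimes> x = x"
proof -
  have x: "x = e \<otimes> (e \<leadsto> x)" using divisibility[of x e] assms by simp
  then have "e \<otimes> x = (e \<otimes> e) \<otimes> (e \<leadsto> x)" using assms m_assoc[of e e "e \<leadsto> x"] by simp
  with x show ?thesis using assms(3) by simp
qed

text \<open>Absorption gives z = e * z, and e * z \<le> e * x by monotonicity. So an upper bound e *
  x can be checked one factor at a time.\<close>

lemma imp_idem_mult:
  assumes "e \<in> carrier A" "x \<in> carrier A" "z \<in> carrier A"
    and "e \<otimes> e = e" "z \<leadsto> e = \<one>" "z \<leadsto> x = \<one>"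
  shows "z \<leadsto> (e \<otimes> x) = \<one>"
  using mult_mono[of e e z x] idem_mult_absorb[of e z] assms imp_self by simp

text \<open>The meet e * (e -> x) lies below \<open>e\<close> and \<open>x\<close>, hence below e *
  x; conversely x \<le> e -> x, and multiplying by \<open>e\<close> gives the other
  inequality.\<close>

lemma meet_idem:
  assumes "e \<in> carrier A" "x \<in> carrier A" "e \<otimes> e = e"
  shows "hoop_meet A e x = e \<otimes> x"
proof -
  have "e \<otimes> (e \<leadsto> x) = e \<otimes> x"
  proof (rule imp_antisym)
    show "(e \<otimes> (e \<leadsto> x)) \<leadsto> (e \<otimes> x) = \<one>"
      using assms by (intro imp_idem_mult mult_imp_left meet_below_right) auto
    show "(e \<otimes> x) \<leadsto> (e \<otimes> (e \<leadsto> x)) = \<one>"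
      using mult_mono[of e e x "e \<leadsto> x"] imp_curry[of x e x] mult_imp_left[of x e] imp_self assms
      by simp
  qed (use assms in auto)
  then show ?thesis using meet_eq assms by simp
qed

end

theorem theorem8:
  fixes A :: "('a, 'm) hoop_algebra_scheme"
    and B :: "('b, 'n) hoop_algebra_scheme"
    and f :: "'b \<Rightarrow> 'a"
  assumes "hoop A"
    and "hoop B"
    and "product_morphism B A f"
  shows "hoop (f_product A f B)"
proof -
  interpret A: hoop A by fact
  interpret B: hoop B by fact
  have f_closed [simp]: "f x \<in> carrier A" if "x \<in> carrier B" for x
    using assms(3) that by (auto simp: product_morphism_def)
  have f_one [simp]: "f \<one>\<^bsub>B\<^esub> = \<one>\<^bsub>A\<^esub>"
    using assms(3) by (simp add: product_morphism_def)
  have f_mult: "f (x \<otimes>\<^bsub>B\<^esub> y) = f x \<otimes>\<^bsub>A\<^esub> f y"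
    if "x \<in> carrier B" "y \<in> carrier B" for x y
    using assms(3) that by (simp add: product_morphism_def)
  have f_meet: "f (x \<otimes>\<^bsub>B\<^esub> (x \<leadsto>\<^bsub>B\<^esub> y)) = f x \<otimes>\<^bsub>A\<^esub> f y"
    if "x \<in> carrier B" "y \<in> carrier B" for x y
    using assms(3) that B.meet_eq[OF that] by (simp add: product_morphism_def)
  \<comment> \<open>On the diagonal the factor x -> x in \<open>f_meet\<close> is the unit.\<close>
  have f_idem: "f x \<otimes>\<^bsub>A\<^esub> f x = f x" if "x \<in> carrier B" for x
    using f_meet[OF that that] that B.imp_self by simp
  \<comment> \<open>If x -> y is the unit, \<open>f_meet\<close> reads f x = f x * f y, a multiple
    of f y.\<close>
  have f_mono: "f x \<leadsto>\<^bsub>A\<^esub> f y = \<one>\<^bsub>A\<^esub>"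
    if "x \<in> carrier B" "y \<in> carrier B" "x \<leadsto>\<^bsub>B\<^esub> y = \<one>\<^bsub>B\<^esub>" for x y
    using f_meet[OF that(1,2)] that A.mult_imp_left[of "f y" "f x"] A.m_comm[of "f x" "f y"]
    by simp
  let ?P = "f_product A f B"
  have carrier_iff [simp]: "(a, x) \<in> carrier ?P \<longleftrightarrow>
      a \<in> carrier A \<and> x \<in> carrier B \<and> a \<leadsto>\<^bsub>A\<^esub> f x = \<one>\<^bsub>A\<^esub>" for a x
    by (simp add: f_product_def)
  have mult_eq [simp]: "(a, x) \<otimes>\<^bsub>?P\<^esub> (b, y) = (a \<otimes>\<^bsub>A\<^esub> b, x \<otimes>\<^bsub>B\<^esub> y)" for a x b y
    by (simp add: f_product_def)
  have one_eq [simp]: "\<one>\<^bsub>?P\<^esub> = (\<one>\<^bsub>A\<^esub>, \<one>\<^bsub>B\<^esub>)"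
    by (simp add: f_product_def)
  have imp_eq [simp]: "(a, x) \<leadsto>\<^bsub>?P\<^esub> (b, y) =
      (f (x \<leadsto>\<^bsub>B\<^esub> y) \<otimes>\<^bsub>A\<^esub> (a \<leadsto>\<^bsub>A\<^esub> b), x \<leadsto>\<^bsub>B\<^esub> y)"
    if "a \<in> carrier A" "b \<in> carrier A" "x \<in> carrier B" "y \<in> carrier B" for a x b y
    using that A.meet_idem f_idem by (simp add: f_product_def)
  have curry: "f ((x \<otimes>\<^bsub>B\<^esub> y) \<leadsto>\<^bsub>B\<^esub> z) \<otimes>\<^bsub>A\<^esub> ((a \<otimes>\<^bsub>A\<^esub> b) \<leadsto>\<^bsub>A\<^esub> c) =
      f (x \<leadsto>\<^bsub>B\<^esub> (y \<leadsto>\<^bsub>B\<^esub> z)) \<otimes>\<^bsub>A\<^esub>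
        (a \<leadsto>\<^bsub>A\<^esub> (f (y \<leadsto>\<^bsub>B\<^esub> z) \<otimes>\<^bsub>A\<^esub> (b \<leadsto>\<^bsub>A\<^esub> c)))"
    if a: "a \<in> carrier A" and b: "b \<in> carrier A" and c: "c \<in> carrier A"
      and x: "x \<in> carrier B" and y: "y \<in> carrier B" and z: "z \<in> carrier B"
      and ax: "a \<leadsto>\<^bsub>A\<^esub> f x = \<one>\<^bsub>A\<^esub>" for a b c x y z
  proof -
    \<comment> \<open>After currying in both hoops the goal is e * (a -> u) = e * (a -> (f v * u)):
      in the presence of \<open>e\<close>, the factor f v may be inserted under the
      implication.\<close>
    define v where "v = y \<leadsto>\<^bsub>B\<^esub> z"
    define u where "u = b \<leadsto>\<^bsub>A\<^esub> c"
    define e where "e = f (x \<leadsto>\<^bsub>B\<^esub> v)"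
    have v: "v \<in> carrier B" and u: "u \<in> carrier A" and e: "e \<in> carrier A" "e \<otimes>\<^bsub>A\<^esub> e = e"
      using that f_idem by (auto simp: v_def u_def e_def)
    let ?w = "a \<leadsto>\<^bsub>A\<^esub> u"
    have "(a \<otimes>\<^bsub>A\<^esub> e) \<leadsto>\<^bsub>A\<^esub> (f x \<otimes>\<^bsub>A\<^esub> e) = \<one>\<^bsub>A\<^esub>"
      using a x e ax by (intro A.mult_mono_left) auto
    moreover have "(f x \<otimes>\<^bsub>A\<^esub> e) \<leadsto>\<^bsub>A\<^esub> f v = \<one>\<^bsub>A\<^esub>"
      using f_mult[of x "x \<leadsto>\<^bsub>B\<^esub> v"] f_mono[OF _ _ B.meet_below_right[of x v]] x v
      by (simp add: e_def)
    ultimately have aev: "(a \<otimes>\<^bsub>A\<^esub> e) \<leadsto>\<^bsub>A\<^esub> f v = \<one>\<^bsub>A\<^esub>"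
      by (rule A.imp_trans[rotated 3]) (use a x e v in auto)
    \<comment> \<open>By residuation the harder inequality amounts to e * w * a \<le> f v * u, where
      w = a -> u. As f v is idempotent, two separate bounds suffice: a * e is below f v, and a * w
      is below \<open>u\<close>.\<close>
    have "(e \<otimes>\<^bsub>A\<^esub> ?w) \<otimes>\<^bsub>A\<^esub> a = (a \<otimes>\<^bsub>A\<^esub> e) \<otimes>\<^bsub>A\<^esub> ?w"
      using a e u by (simp add: A.m_ac)
    moreover have "((a \<otimes>\<^bsub>A\<^esub> e) \<otimes>\<^bsub>A\<^esub> ?w) \<leadsto>\<^bsub>A\<^esub> f v = \<one>\<^bsub>A\<^esub>"
      by (rule A.imp_trans[OF _ _ _ A.mult_imp_left aev]) (use a e u v in auto)
    moreover have "((a \<otimes>\<^bsub>A\<^esub> e) \<otimes>\<^bsub>A\<^esub> ?w) \<leadsto>\<^bsub>A\<^esub> u = \<one>\<^bsub>A\<^esub>"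
    proof -
      have "(a \<otimes>\<^bsub>A\<^esub> e) \<otimes>\<^bsub>A\<^esub> ?w = (a \<otimes>\<^bsub>A\<^esub> ?w) \<otimes>\<^bsub>A\<^esub> e"
        using a e u by (simp add: A.m_ac)
      then show ?thesis
        using A.imp_trans[OF _ _ _ A.mult_imp_left A.meet_below_right, of a u e] a e u by simp
    qed
    ultimately have "((e \<otimes>\<^bsub>A\<^esub> ?w) \<otimes>\<^bsub>A\<^esub> a) \<leadsto>\<^bsub>A\<^esub> (f v \<otimes>\<^bsub>A\<^esub> u) = \<one>\<^bsub>A\<^esub>"
      using a e u v f_idem by (simp add: A.imp_idem_mult)
    then have le: "(e \<otimes>\<^bsub>A\<^esub> ?w) \<leadsto>\<^bsub>A\<^esub> (a \<leadsto>\<^bsub>A\<^esub> (f v \<otimes>\<^bsub>A\<^esub> u)) = \<one>\<^bsub>A\<^esub>"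
      using A.imp_curry a e u v by simp
    have "e \<otimes>\<^bsub>A\<^esub> ?w = e \<otimes>\<^bsub>A\<^esub> (a \<leadsto>\<^bsub>A\<^esub> (f v \<otimes>\<^bsub>A\<^esub> u))"
    proof (rule A.imp_antisym)
      \<comment> \<open>The left side is also below the idempotent \<open>e\<close>, so
        \<open>le\<close> survives multiplication of its right side by \<open>e\<close>. The
        converse only drops the factor f v.\<close>
      show "(e \<otimes>\<^bsub>A\<^esub> ?w) \<leadsto>\<^bsub>A\<^esub> (e \<otimes>\<^bsub>A\<^esub> (a \<leadsto>\<^bsub>A\<^esub> (f v \<otimes>\<^bsub>A\<^esub> u))) = \<one>\<^bsub>A\<^esub>"
        using a e u v le by (intro A.imp_idem_mult A.mult_imp_left) auto
      have "(f v \<otimes>\<^bsub>A\<^esub> u) \<leadsto>\<^bsub>A\<^esub> u = \<one>\<^bsub>A\<^esub>"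
        using A.mult_imp_left[of u "f v"] A.m_comm u v by simp
      then show "(e \<otimes>\<^bsub>A\<^esub> (a \<leadsto>\<^bsub>A\<^esub> (f v \<otimes>\<^bsub>A\<^esub> u))) \<leadsto>\<^bsub>A\<^esub> (e \<otimes>\<^bsub>A\<^esub> ?w) = \<one>\<^bsub>A\<^esub>"
        using a e u v by (intro A.mult_mono A.imp_mono_right) (auto simp: A.imp_self)
    qed (use a e u v in auto)
    then show ?thesis
      using a b c x y z by (simp add: e_def u_def v_def A.imp_curry B.imp_curry)
  qed
  \<comment> \<open>Each of the two outer factors on the right is symmetric, by divisibility in
    \<open>B\<close> and in \<open>A\<close>; this yields divisibility for the first
    components.\<close>
  have meet: "a \<otimes>\<^bsub>A\<^esub> (f (x \<leadsto>\<^bsub>B\<^esub> y) \<otimes>\<^bsub>A\<^esub> (a \<leadsto>\<^bsub>A\<^esub> b)) =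
      f (x \<otimes>\<^bsub>B\<^esub> (x \<leadsto>\<^bsub>B\<^esub> y)) \<otimes>\<^bsub>A\<^esub> (a \<otimes>\<^bsub>A\<^esub> (a \<leadsto>\<^bsub>A\<^esub> b))"
    if a: "a \<in> carrier A" and b: "b \<in> carrier A" and x: "x \<in> carrier B" and y: "y \<in> carrier B"
      and ax: "a \<leadsto>\<^bsub>A\<^esub> f x = \<one>\<^bsub>A\<^esub>" for a b x y
  proof -
    have "a = f x \<otimes>\<^bsub>A\<^esub> a"
      using A.idem_mult_absorb[of "f x" a] f_idem a x ax by simp
    then have "a \<otimes>\<^bsub>A\<^esub> (f (x \<leadsto>\<^bsub>B\<^esub> y) \<otimes>\<^bsub>A\<^esub> (a \<leadsto>\<^bsub>A\<^esub> b)) =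
        (f x \<otimes>\<^bsub>A\<^esub> a) \<otimes>\<^bsub>A\<^esub> (f (x \<leadsto>\<^bsub>B\<^esub> y) \<otimes>\<^bsub>A\<^esub> (a \<leadsto>\<^bsub>A\<^esub> b))"
      by simp
    also have "\<dots> = f (x \<otimes>\<^bsub>B\<^esub> (x \<leadsto>\<^bsub>B\<^esub> y)) \<otimes>\<^bsub>A\<^esub> (a \<otimes>\<^bsub>A\<^esub> (a \<leadsto>\<^bsub>A\<^esub> b))"
      using a b x y by (simp add: f_mult A.m_ac)
    finally show ?thesis .
  qed
  \<comment> \<open>The factor f(x -> y) cuts a -> b down so that the implication stays in the
    carrier.\<close>
  have imp_carrier: "(f (x \<leadsto>\<^bsub>B\<^esub> y) \<otimes>\<^bsub>A\<^esub> (a \<leadsto>\<^bsub>A\<^esub> b)) \<leadsto>\<^bsub>A\<^esub> f (x \<leadsto>\<^bsub>B\<^esub> y) = \<one>\<^bsub>A\<^esub>"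
    if "a \<in> carrier A" "b \<in> carrier A" "x \<in> carrier B" "y \<in> carrier B" for a b x y
    using that by (simp add: A.mult_imp_left)
  \<comment> \<open>Closure under products: a \<le> f x and b \<le> f y give a * b \<le> f x * f y =
    f(x * y).\<close>
  have "comm_monoid ?P"
    by (rule comm_monoidI)
      (auto simp: A.m_ac B.m_ac f_mult A.imp_self A.mult_mono)
  moreover have "hoop_axioms ?P"
  proof
    fix p q assume "p \<in> carrier ?P" "q \<in> carrier ?P"
    then show "p \<leadsto>\<^bsub>?P\<^esub> q \<in> carrier ?P"
      by (cases p; cases q) (simp add: imp_carrier)
  next
    fix p assume "p \<in> carrier ?P"
    then show "p \<leadsto>\<^bsub>?P\<^esub> p = \<one>\<^bsub>?P\<^esub>"
      by (cases p) (simp add: A.imp_self B.imp_self)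
  next
    fix p q r assume "p \<in> carrier ?P" "q \<in> carrier ?P" "r \<in> carrier ?P"
    then show "(p \<otimes>\<^bsub>?P\<^esub> q) \<leadsto>\<^bsub>?P\<^esub> r = p \<leadsto>\<^bsub>?P\<^esub> (q \<leadsto>\<^bsub>?P\<^esub> r)"
      by (cases p; cases q; cases r) (simp add: curry, simp add: B.imp_curry)
  next
    fix p q assume "p \<in> carrier ?P" "q \<in> carrier ?P"
    then show "p \<otimes>\<^bsub>?P\<^esub> (p \<leadsto>\<^bsub>?P\<^esub> q) = q \<otimes>\<^bsub>?P\<^esub> (q \<leadsto>\<^bsub>?P\<^esub> p)"
      by (cases p; cases q) (simp add: meet A.divisibility B.divisibility)
  qed
  ultimately show ?thesis by (rule hoop.intro)
qed

end
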